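(* Let $n\in\mathbb{Q}\setminus\{0\}$. Then the Diophantine equation $$T^2=n(X_1^5+X_2^5-2X_3^5)$$ has a solution in co-prime polynomials $X_1,X_2,X_3,T\in\mathbb{Z}[t,w]$. *)

theory Defs
  imports "HOL-Computational_Algebra.Computational_Algebra"
begin

(* The ring Z[t,w] is rendered as Z[t][w], the type int poly poly: the outer indeterminate is w,
   the coefficients are polynomials in t. *)

(* The inclusion of Z[t,w] into Q[t,w], needed because n is only rational. *)
definition rat_poly2 :: "int poly poly \<Rightarrow> rat poly poly" where
  "rat_poly2 = map_poly (map_poly rat_of_int)"

definition const2 :: "rat \<Rightarrow> rat poly poly" where
  "const2 c = [:[:c:]:]"

definition involves_w :: "int poly poly \<Rightarrow> bool" where
  "involves_w p \<longleftrightarrow> degree p > 0"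

definition involves_t :: "int poly poly \<Rightarrow> bool" where
  "involves_t p \<longleftrightarrow> (\<exists>i. degree (coeff p i) > 0)"

(* The equation has coprime solutions that hold for no reason other than cancellation of terms,
   such as (1,1,1,0) and, for n = a/b, (t, -t, -2ab w^2, 8 a^3 b^2 w^5).  They are excluded by
   asking that T and all subsums of X1^5 + X2^5 - 2 X3^5 be nonzero (X1^5 + X2^5 = 0 means
   X1 + X2 = 0; X1^5 = 2 X3^5 and X2^5 = 2 X3^5 force both sides to vanish, so these subsums need
   no clause of their own).
   Solutions in Z[t] or in Z[w] alone are excluded as well, in particular constant ones. *)
definition nondegenerate ::
  "int poly poly \<Rightarrow> int poly poly \<Rightarrow> int poly poly \<Rightarrow> int poly poly \<Rightarrow> bool" where
  "nondegenerate X1 X2 X3 T \<longleftrightarrow>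
     T \<noteq> 0 \<and> X1 \<noteq> 0 \<and> X2 \<noteq> 0 \<and> X3 \<noteq> 0 \<and> X1 + X2 \<noteq> 0 \<and>
     (\<exists>p\<in>{X1, X2, X3, T}. involves_t p) \<and> (\<exists>p\<in>{X1, X2, X3, T}. involves_w p)"

end

theory Submission
  imports Defs
begin

text \<open>
  The substitution \<open>X\<^sub>1 = a + b\<close>, \<open>X\<^sub>2 = a - b\<close>, \<open>X\<^sub>3 = a\<close> gives
  \<open>X\<^sub>1\<^sup>5 + X\<^sub>2\<^sup>5 - 2 X\<^sub>3\<^sup>5 = 10 a b\<^sup>2 (2 a\<^sup>2 + b\<^sup>2)\<close>.
  The conic \<open>2 a\<^sup>2 + b\<^sup>2 = c\<^sup>2\<close> is parametrised by
  \<open>a = 2 r s\<close>, \<open>b = r\<^sup>2 - 2 s\<^sup>2\<close>, \<open>c = r\<^sup>2 + 2 s\<^sup>2\<close>; for \<open>n = p / q\<close> the choice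
  \<open>r = t\<^sup>2\<close>, \<open>s = 5 p q w\<^sup>2\<close> turns \<open>10 n a\<close> into the square of \<open>10 p t w\<close>.
  All of \<open>p q\<close> is put into \<open>s\<close> so that \<open>b\<close> is monic in \<open>t\<close>; as also \<open>t\<close> does not divide \<open>b\<close>, it is
  coprime to \<open>a\<close> whatever the parity of \<open>p q\<close>.
\<close>

text \<open>The factor \<open>q\<close> clears the denominator of \<open>n\<close>; what makes the
  product a square is \<open>p * (10 * a) = q * (10 * p * t * w)^2\<close>.\<close>

lemma quintic_identity:
  fixes p q t w :: "'a :: comm_ring_1"
  defines "a \<equiv> 10 * p * q * t\<^sup>2 * w\<^sup>2"
    and "b \<equiv> t ^ 4 - 50 * p\<^sup>2 * q\<^sup>2 * w ^ 4"
    and "c \<equiv> t ^ 4 + 50 * p\<^sup>2 * q\<^sup>2 * w ^ 4"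
  shows "q * (10 * p * t * w * b * c)\<^sup>2 = p * ((a + b) ^ 5 + (a - b) ^ 5 - 2 * a ^ 5)"
proof -
  have conic: "2 * a\<^sup>2 + b\<^sup>2 = c\<^sup>2"
    unfolding a_def b_def c_def by (simp add: algebra_simps power2_eq_square eval_nat_numeral)
  have "(a + b) ^ 5 + (a - b) ^ 5 - 2 * a ^ 5 = 10 * a * b\<^sup>2 * (2 * a\<^sup>2 + b\<^sup>2)"
    by (simp add: algebra_simps power2_eq_square eval_nat_numeral)
  also have "\<dots> = 10 * a * b\<^sup>2 * c\<^sup>2"
    by (simp only: conic)
  finally show ?thesis
    by (simp add: a_def power_mult_distrib power2_eq_square mult_ac)
qed

text \<open>\<open>rat_poly2\<close> nests two \<open>map_poly\<close>s, so here and in the next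
  lemma the laws of \<open>f\<close> are hypotheses: each lemma serves the inner map and then the
  outer one.\<close>

lemma map_poly_add_hom:
  assumes "f 0 = 0" "\<And>x y. f (x + y) = f x + f y"
  shows "map_poly f (p + q) = map_poly f p + map_poly f q"
  by (rule poly_eqI) (simp add: coeff_map_poly assms)

lemma map_poly_mult_hom:
  fixes f :: "'a :: comm_semiring_0 \<Rightarrow> 'b :: comm_semiring_0"
  assumes f0: "f 0 = 0" and fadd: "\<And>x y. f (x + y) = f x + f y"
    and fmult: "\<And>x y. f (x * y) = f x * f y"
  shows "map_poly f (p * q) = map_poly f p * map_poly f q"
proof (rule poly_eqI)
  fix k
  have "f (\<Sum>i\<in>A. g i) = (\<Sum>i\<in>A. f (g i))" for g :: "nat \<Rightarrow> 'a" and A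
    by (induction A rule: infinite_finite_induct) (simp_all add: f0 fadd)
  then show "coeff (map_poly f (p * q)) k = coeff (map_poly f p * map_poly f q) k"
    by (simp add: coeff_map_poly f0 coeff_mult fmult)
qed

lemma rat_poly2_add: "rat_poly2 (p + q) = rat_poly2 p + rat_poly2 q"
  unfolding rat_poly2_def by (intro map_poly_add_hom) (simp_all add: map_poly_add_hom)

lemma rat_poly2_mult: "rat_poly2 (p * q) = rat_poly2 p * rat_poly2 q"
  unfolding rat_poly2_def
  by (intro map_poly_mult_hom) (simp_all add: map_poly_add_hom map_poly_mult_hom)

lemma rat_poly2_diff: "rat_poly2 (p - q) = rat_poly2 p - rat_poly2 q"
  using rat_poly2_add[of "p - q" q] by simp

lemma rat_poly2_of_int: "rat_poly2 (of_int m) = const2 (of_int m)"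
  by (simp add: rat_poly2_def const2_def of_int_poly map_poly_pCons)

lemma rat_poly2_power: "rat_poly2 (p ^ k) = rat_poly2 p ^ k"
  using rat_poly2_of_int[of 1]
  by (induction k) (simp_all add: rat_poly2_mult const2_def flip: one_pCons)

text \<open>Both \<open>b\<close> and \<open>c\<close> have this shape; the monomial form lets their
  coefficients in \<open>w\<close> be read off.\<close>

lemma quartic_eq_monom:
  "[:[:0, 1:]:] ^ 4 + of_int m * [:0, 1:] ^ 4 = monom (monom 1 4) 0 + monom [:m:] 4"
  (is "?t ^ 4 + _ * ?w ^ 4 = _")
proof -
  have t: "?t = monom (monom 1 1) 0" and w: "?w = monom 1 1"
    and m: "(of_int m :: int poly poly) = monom [:m:] 0"
    by (simp_all add: monom_altdef of_int_poly)
  show ?thesis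
    unfolding t w m monom_power mult_monom by simp
qed

text \<open>For \<open>k = p * q\<close> the two multiples of \<open>d\<close> are \<open>a\<close>
  and \<open>b\<close>. First \<open>w\<close>, then \<open>t\<close> is excluded from
  \<open>d\<close>, leaving an integer.\<close>

lemma coprime_quartic_monomial:
  fixes k :: int
  defines "t \<equiv> [:[:0, 1:]:]" and "w \<equiv> [:0, 1:]"
  assumes "k \<noteq> 0" "d dvd 10 * of_int k * t\<^sup>2 * w\<^sup>2" "d dvd t ^ 4 - 50 * (of_int k)\<^sup>2 * w ^ 4"
  shows "is_unit (d :: int poly poly)"
proof -
  let ?b = "t ^ 4 - 50 * (of_int k)\<^sup>2 * w ^ 4"
  \<comment> \<open>This combination cancels the \<open>w ^ 4\<close> term; a divisor of
    \<open>t ^ 6\<close> has degree 0 in \<open>w\<close>.\<close>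
  have "d dvd t\<^sup>2 * ?b + 5 * of_int k * w\<^sup>2 * (10 * of_int k * t\<^sup>2 * w\<^sup>2)"
    by (rule dvd_add) (use assms(4,5) in \<open>blast intro: dvd_mult\<close>)+
  also have "\<dots> = t ^ 6"
    by (simp add: algebra_simps power2_eq_square eval_nat_numeral)
  finally have "d dvd [:[:0, 1:] ^ 6:]"
    unfolding t_def poly_const_pow .
  from dvd_imp_degree_le[OF this] have "degree d = 0"
    by simp
  then obtain e where d: "d = [:e:]"
    by (rule degree_eq_zeroE)
  have b: "?b = monom (monom 1 4) 0 + monom [:- (50 * k\<^sup>2):] 4"
    using quartic_eq_monom[of "- (50 * k\<^sup>2)"] by (simp add: t_def w_def)
  have e: "e dvd coeff ?b i" for i
    using assms(5) unfolding d const_poly_dvd_iff by blast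
  \<comment> \<open>The coefficient of \<open>w ^ 4\<close> is a nonzero integer, so
    \<open>e\<close> is free of \<open>t\<close>.\<close>
  have "e dvd [:- (50 * k\<^sup>2):]"
    using e[of 4] unfolding b by simp
  from dvd_imp_degree_le[OF this] have "degree e = 0"
    using \<open>k \<noteq> 0\<close> by simp
  then obtain f where f: "e = [:f:]"
    by (rule degree_eq_zeroE)
  \<comment> \<open>The coefficient of \<open>w ^ 0\<close> is \<open>t ^ 4\<close>, whose leading
    coefficient 1 forces \<open>f\<close> to be a unit.\<close>
  have "[:f:] dvd monom 1 4"
    using e[of 0] unfolding b f by simp
  then have "f dvd coeff (monom 1 4) 4"
    unfolding const_poly_dvd_iff by blast
  then show ?thesis
    by (simp add: d f is_unit_const_poly_iff)
qed

theorem theorem4p2: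
  fixes n :: rat
  assumes "n \<noteq> 0"
  shows "\<exists>X1 X2 X3 T :: int poly poly.
           (rat_poly2 T) ^ 2
             = const2 n * ((rat_poly2 X1) ^ 5 + (rat_poly2 X2) ^ 5 - 2 * (rat_poly2 X3) ^ 5) \<and>
           Gcd {X1, X2, X3, T} = 1 \<and>
           nondegenerate X1 X2 X3 T"
proof -
  obtain p q :: int where n: "n = of_int p / of_int q" and q: "q > 0"
    using quotient_of_div[of n] quotient_of_denom_pos by (metis prod.collapse)
  have p: "p \<noteq> 0"
    using assms n by auto
  define t w :: "int poly poly" where "t = [:[:0, 1:]:]" and "w = [:0, 1:]"
  define a b c :: "int poly poly" where
    "a = 10 * of_int p * of_int q * t\<^sup>2 * w\<^sup>2" and
    "b = t ^ 4 - 50 * (of_int p)\<^sup>2 * (of_int q)\<^sup>2 * w ^ 4" and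
    "c = t ^ 4 + 50 * (of_int p)\<^sup>2 * (of_int q)\<^sup>2 * w ^ 4"
  define T where "T = 10 * of_int p * t * w * b * c"

  \<comment> \<open>Writing 2 as \<open>of_int 2\<close> lets \<open>rat_poly2_of_int\<close>
    rewrite it.\<close>
  have "of_int q * T\<^sup>2 = of_int p * ((a + b) ^ 5 + (a - b) ^ 5 - of_int 2 * a ^ 5)"
    using quintic_identity[of "of_int q" "of_int p" t w] unfolding T_def a_def b_def c_def by simp
  from arg_cong[where f = rat_poly2, OF this]
  have "const2 (of_int q) * rat_poly2 T ^ 2
      = const2 (of_int p) * (rat_poly2 (a + b) ^ 5 + rat_poly2 (a - b) ^ 5 - const2 2 * rat_poly2 a ^ 5)"
    unfolding rat_poly2_add rat_poly2_diff rat_poly2_mult rat_poly2_power rat_poly2_of_int by simp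
  moreover have "const2 (of_int p) = const2 (of_int q) * const2 n"
    using q by (simp add: const2_def n)
  moreover have "const2 2 = 2"
    by (simp add: const2_def numeral_poly)
  moreover have "const2 (of_int q) \<noteq> 0"
    using q by (simp add: const2_def)
  ultimately have eqn: "rat_poly2 T ^ 2
      = const2 n * (rat_poly2 (a + b) ^ 5 + rat_poly2 (a - b) ^ 5 - 2 * rat_poly2 a ^ 5)"
    by (simp add: mult.assoc)

  \<comment> \<open>The gcd divides \<open>a\<close> and \<open>a + b\<close>, hence
    \<open>b\<close>.\<close>
  have "is_unit (Gcd {a + b, a - b, a, T})"
  proof (rule coprime_quartic_monomial[of "p * q"])
    let ?g = "Gcd {a + b, a - b, a, T}"
    show "p * q \<noteq> 0"
      using p q by simp
    have ga: "?g dvd a"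
      by (rule Gcd_dvd) simp
    then show "?g dvd 10 * of_int (p * q) * [:[:0, 1:]:]\<^sup>2 * [:0, 1:]\<^sup>2"
      by (simp add: a_def t_def w_def mult.assoc)
    have "?g dvd a + b"
      by (rule Gcd_dvd) simp
    then have "?g dvd b"
      using ga dvd_add_right_iff by blast
    then show "?g dvd [:[:0, 1:]:] ^ 4 - 50 * (of_int (p * q))\<^sup>2 * [:0, 1:] ^ 4"
      by (simp add: b_def t_def w_def power_mult_distrib mult.assoc)
  qed
  then have "Gcd {a + b, a - b, a, T} = 1"
    using normalize_Gcd is_unit_normalize by metis
  moreover have "nondegenerate (a + b) (a - b) a T"
  proof -
    have t_monom: "t = monom (monom 1 1) 0" and w_monom: "w = monom 1 1"
      and const_monom: "10 * of_int p * of_int q = monom (monom (10 * p * q) 0) 0"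
      by (simp_all add: t_def w_def monom_altdef of_int_poly numeral_poly)
    have a: "a = monom (monom (10 * p * q) 2) 2"
      unfolding a_def const_monom t_monom w_monom monom_power mult_monom by (simp add: numeral_2_eq_2)
    have b: "b = monom (monom 1 4) 0 + monom [:- (50 * p\<^sup>2 * q\<^sup>2):] 4"
      using quartic_eq_monom[of "- (50 * p\<^sup>2 * q\<^sup>2)"] by (simp add: b_def t_def w_def)
    have c: "c = monom (monom 1 4) 0 + monom [:50 * p\<^sup>2 * q\<^sup>2:] 4"
      using quartic_eq_monom[of "50 * p\<^sup>2 * q\<^sup>2"] by (simp add: c_def t_def w_def)
    \<comment> \<open>At \<open>w = 0\<close> the polynomial \<open>a\<close> vanishes, while
      \<open>b\<close> and \<open>c\<close> become \<open>t ^ 4\<close>.\<close>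
    have "coeff (a + b) 0 \<noteq> 0" "coeff (a - b) 0 \<noteq> 0" "coeff b 0 \<noteq> 0" "coeff c 0 \<noteq> 0"
      by (simp_all add: a b c)
    then have nz: "a + b \<noteq> 0" "a - b \<noteq> 0" "b \<noteq> 0" "c \<noteq> 0"
      by (metis coeff_0)+
    \<comment> \<open>\<open>2 * a\<close> is the sum \<open>X1 + X2\<close>.\<close>
    have "a \<noteq> 0" "2 * a \<noteq> 0"
      using p q by (simp_all add: a)
    moreover have "T \<noteq> 0"
      using nz p by (simp add: T_def t_def w_def)
    \<comment> \<open>\<open>X3 = a\<close> alone witnesses both \<open>t\<close> and
      \<open>w\<close>.\<close>
    moreover have "degree a = 2" "degree (coeff a 2) = 2"
      using p q by (simp_all add: a degree_monom_eq)
    ultimately show ?thesis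
      using nz unfolding nondegenerate_def involves_t_def involves_w_def
      by (auto simp: intro!: exI[of _ 2])
  qed
  ultimately show ?thesis
    using eqn by blast
qed

end
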